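(* Let $A,C,\sigma,R_a$ be positive real numbers and consider the system $$\dot x=Ayz+Cz-\sigma x,\qquad \dot y=-xz+R_a-y,\qquad \dot z=-z+xy$$ on $\mathbb{R}^3$. There exists a positive number $M$ such that the ellipsoid $$S_M=\left\{(x,y,z)\in\mathbb{R}^3:\ \frac{\sigma x^2}{2}+\frac{(A\sigma+C^2)y^2}{2}+\frac{C^2z^2}{2}\le M\right\}$$ is a global attractor of the system, in the sense that any solution $(x(t),y(t),z(t))$ with initial condition $(x(0),y(0),z(0))$ outside $S_M$ will enter $S_M$ as $t\to+\infty$. Thus the system is ultimately bounded.
   Context: "Enter $S_M$ as $t\to+\infty$" means that there is a time $T\geq 0$ (depending on the solution) at which the solution is in $S_M$. "Ultimately bounded" means that there is a constant $B>0$ such that for every solution there is $T\ge 0$ with $\|(x(t),y(t),z(t))\|\le B$ for all $t\ge T$. *)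

theory Defs
  imports "HOL-Analysis.Analysis"
begin

text \<open>A solution is a curve on \<open>[0, \<infinity>)\<close>; the values of \<open>u\<close> at negative
  times are irrelevant, and the derivative at time 0 is the one-sided one.\<close>

definition forward_solution :: "('a::real_normed_vector \<Rightarrow> 'a) \<Rightarrow> (real \<Rightarrow> 'a) \<Rightarrow> bool" where
  "forward_solution f u \<longleftrightarrow>
     (\<forall>t\<ge>0. (u has_vector_derivative f (u t)) (at t within {0..}))"

definition enters :: "(real \<Rightarrow> 'a) \<Rightarrow> 'a set \<Rightarrow> bool" where
  "enters u S \<longleftrightarrow> (\<exists>T\<ge>0. u T \<in> S)"

definition global_attractor :: "('a::real_normed_vector \<Rightarrow> 'a) \<Rightarrow> 'a set \<Rightarrow> bool" where
  "global_attractor f S \<longleftrightarrow> (\<forall>u. forward_solution f u \<and> u 0 \<notin> S \<longrightarrow> enters u S)"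

definition ultimately_bounded :: "('a::real_normed_vector \<Rightarrow> 'a) \<Rightarrow> bool" where
  "ultimately_bounded f \<longleftrightarrow>
     (\<exists>B>0. \<forall>u. forward_solution f u \<longrightarrow> (\<exists>T\<ge>0. \<forall>t\<ge>T. norm (u t) \<le> B))"

text \<open>The phase space is \<open>real \<times> real \<times> real\<close>, whose library norm is the Euclidean norm.\<close>

definition vfield :: "real \<Rightarrow> real \<Rightarrow> real \<Rightarrow> real \<Rightarrow> real \<times> real \<times> real \<Rightarrow> real \<times> real \<times> real" where
  "vfield A C \<sigma> Ra = (\<lambda>(x, y, z).
     (A * y * z + C * z - \<sigma> * x, - x * z + Ra - y, - z + x * y))"

definition ellipsoid :: "real \<Rightarrow> real \<Rightarrow> real \<Rightarrow> real \<Rightarrow> (real \<times> real \<times> real) set" where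
  "ellipsoid A C \<sigma> M = {(x, y, z).
     \<sigma> * x\<^sup>2 / 2 + (A * \<sigma> + C\<^sup>2) * y\<^sup>2 / 2 + C\<^sup>2 * z\<^sup>2 / 2 \<le> M}"

end

theory Submission
  imports Defs
begin

text \<open>The quadratic form \<open>V\<close> defining the ellipsoid is a Lyapunov function: its weights make the
  cubic terms \<open>xyz\<close> of \<open>dV/dt\<close> cancel, and the cross term \<open>\<sigma>Cxz\<close> is dominated by
  \<open>\<sigma>\<^sup>2x\<^sup>2 + C\<^sup>2z\<^sup>2\<close>. Hence \<open>dV/dt \<le> K - k V\<close> with constants \<open>k, K > 0\<close>, so that every solution
  is eventually in \<open>V \<le> K / k + 1\<close>.\<close>

text \<open>Gronwall's argument with the integrating factor \<open>exp (k * t)\<close>: the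
  inequality on \<open>V'\<close> says exactly that \<open>(V t - K / k) * exp (k * t)\<close> has
  nonpositive derivative.\<close>

lemma dissipative_bound:
  fixes V :: "real \<Rightarrow> real"
  assumes k: "k > 0"
    and der: "\<And>t. t \<ge> 0 \<Longrightarrow> (V has_real_derivative V' t) (at t within {0..})"
    and le: "\<And>t. t \<ge> 0 \<Longrightarrow> V' t \<le> K - k * V t"
    and t: "t \<ge> 0"
  shows "V t \<le> K / k + (V 0 - K / k) * exp (- (k * t))"
proof -
  define W where "W t = (V t - K / k) * exp (k * t)" for t
  have W: "(W has_real_derivative (V' t - (K - k * V t)) * exp (k * t)) (at t within {0..})"
    if "t \<ge> 0" for t
  proof -
    have "(W has_real_derivative V' t * exp (k * t) + exp (k * t) * k * (V t - K / k))
        (at t within {0..})"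
      unfolding W_def by (rule derivative_eq_intros der that refl | simp)+
    moreover have "V' t * exp (k * t) + exp (k * t) * k * (V t - K / k)
        = (V' t - (K - k * V t)) * exp (k * t)"
      using k by (simp add: algebra_simps)
    ultimately show ?thesis by simp
  qed
  have "W t \<le> W 0"
  \<comment> \<open>At time 0 only a one-sided derivative is given. The open version of the
    monotonicity rule asks for two-sided derivatives at interior times only, and for mere continuity
    at the endpoints.\<close>
  proof (rule DERIV_nonpos_imp_decreasing_open [OF t])
    fix s :: real assume s: "0 < s" "s < t"
    then have "(W has_real_derivative (V' s - (K - k * V s)) * exp (k * s)) (at s)"
      using W [of s] by (simp add: at_within_interior [of s "{0..}"])
    moreover have "(V' s - (K - k * V s)) * exp (k * s) \<le> 0"
      using le [of s] s by (simp add: mult_le_0_iff)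
    ultimately show "\<exists>y. (W has_real_derivative y) (at s) \<and> y \<le> 0" by blast
  next
    have "continuous_on {0..} W"
      by (rule DERIV_continuous_on) (use W in auto)
    then show "continuous_on {0..t} W"
      by (rule continuous_on_subset) auto
  qed
  then have "V t - K / k \<le> (V 0 - K / k) / exp (k * t)"
    by (simp add: W_def pos_le_divide_eq)
  then show ?thesis
    by (simp add: exp_minus divide_inverse)
qed

text \<open>The exponential bound tends to \<open>K / k\<close> but may stay above it at all times,
  so the level \<open>M\<close> has to exceed \<open>K / k\<close> strictly.\<close>

lemma dissipative_eventually_le:
  fixes V :: "real \<Rightarrow> real"
  assumes k: "k > 0"
    and der: "\<And>t. t \<ge> 0 \<Longrightarrow> (V has_real_derivative V' t) (at t within {0..})"
    and le: "\<And>t. t \<ge> 0 \<Longrightarrow> V' t \<le> K - k * V t"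
    and M: "M > K / k"
  shows "\<exists>T\<ge>0. \<forall>t\<ge>T. V t \<le> M"
proof -
  have "LIM t at_top. - (k * t) :> at_bot"
    using k by (intro filterlim_uminus_at_bot_at_top [THEN filterlim_compose]
        filterlim_tendsto_pos_mult_at_top [OF tendsto_const] filterlim_ident)
  then have "((\<lambda>t. exp (- (k * t))) \<longlongrightarrow> 0) at_top"
    by (rule filterlim_compose [OF exp_at_bot])
  then have "((\<lambda>t. K / k + (V 0 - K / k) * exp (- (k * t))) \<longlongrightarrow> K / k + (V 0 - K / k) * 0) at_top"
    by (intro tendsto_intros)
  then have "\<forall>\<^sub>F t in at_top. K / k + (V 0 - K / k) * exp (- (k * t)) < M"
    by (rule order_tendstoD) (use M in simp)
  \<comment> \<open>The conjunct \<open>t \<ge> 0\<close> also holds at the threshold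
    \<open>T\<close> itself, which yields \<open>T \<ge> 0\<close>.\<close>
  then have "\<forall>\<^sub>F t in at_top. t \<ge> 0 \<and> V t \<le> M"
    using eventually_ge_at_top [of 0]
  proof eventually_elim
    case (elim t)
    then show ?case using dissipative_bound [OF k der le, of t] by force
  qed
  then obtain T where "\<And>t. t \<ge> T \<Longrightarrow> t \<ge> 0 \<and> V t \<le> M"
    by (auto simp: eventually_at_top_linorder)
  then show ?thesis by blast
qed

lemma eventually_in_ellipsoid:
  fixes A C \<sigma> Ra :: real
  assumes pos: "A > 0" "C > 0" "\<sigma> > 0"
    and M: "M > (A * \<sigma> + C\<^sup>2) * Ra\<^sup>2 / 2 / min \<sigma> 1"
    and u: "forward_solution (vfield A C \<sigma> Ra) u"
  shows "\<exists>T\<ge>0. \<forall>t\<ge>T. u t \<in> ellipsoid A C \<sigma> M"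
proof -
  define b where "b = A * \<sigma> + C\<^sup>2"
  define x y z where "x t = fst (u t)" and "y t = fst (snd (u t))" and "z t = snd (snd (u t))" for t
  define V where "V t = \<sigma> * (x t)\<^sup>2 / 2 + b * (y t)\<^sup>2 / 2 + C\<^sup>2 * (z t)\<^sup>2 / 2" for t
  define x' y' z' where "x' t = A * y t * z t + C * z t - \<sigma> * x t"
    and "y' t = - x t * z t + Ra - y t" and "z' t = - z t + x t * y t" for t
  define V' where "V' t = \<sigma> * x t * x' t + b * y t * y' t + C\<^sup>2 * z t * z' t" for t
  have b: "b > 0" unfolding b_def using pos by (simp add: add_pos_pos)
  have u': "(u has_vector_derivative (x' t, y' t, z' t)) (at t within {0..})" if "t \<ge> 0" for t
    using u that
    by (auto simp: forward_solution_def vfield_def x_def y_def z_def x'_def y'_def z'_def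
        case_prod_beta)
  have x: "(x has_real_derivative x' t) (at t within {0..})"
    and y: "(y has_real_derivative y' t) (at t within {0..})"
    and z: "(z has_real_derivative z' t) (at t within {0..})" if "t \<ge> 0" for t
    using bounded_linear.has_vector_derivative [OF bounded_linear_fst u' [OF that]]
      bounded_linear.has_vector_derivative [OF
        bounded_linear_compose [OF bounded_linear_fst bounded_linear_snd] u' [OF that]]
      bounded_linear.has_vector_derivative [OF
        bounded_linear_compose [OF bounded_linear_snd bounded_linear_snd] u' [OF that]]
    by (simp_all add: x_def [abs_def] y_def [abs_def] z_def [abs_def]
        has_real_derivative_iff_has_vector_derivative)
  have V: "(V has_real_derivative V' t) (at t within {0..})" if "t \<ge> 0" for t
    unfolding V_def [abs_def] V'_def
    by (rule derivative_eq_intros x y z that refl | simp)+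
  have le: "V' t \<le> b * Ra\<^sup>2 / 2 - min \<sigma> 1 * V t" for t
  proof -
    \<comment> \<open>The \<open>xyz\<close> terms have total coefficient
      \<open>\<sigma> * A - b + C\<^sup>2 = 0\<close>. Completing squares absorbs the cross term
      \<open>\<sigma> * C * x * z\<close> and the linear term \<open>b * Ra * y\<close>; the latter
      leaves the constant \<open>b * Ra\<^sup>2 / 2\<close>.\<close>
    have "V' t = - (\<sigma> * x t)\<^sup>2 / 2 - (C * z t)\<^sup>2 / 2 - (\<sigma> * x t - C * z t)\<^sup>2 / 2
        - b * (y t)\<^sup>2 / 2 - b * (y t - Ra)\<^sup>2 / 2 + b * Ra\<^sup>2 / 2"
      unfolding V'_def x'_def y'_def z'_def b_def by (simp add: power2_eq_square field_simps)
    also have "\<dots> \<le> b * Ra\<^sup>2 / 2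
        - (\<sigma> * (\<sigma> * (x t)\<^sup>2 / 2) + b * (y t)\<^sup>2 / 2 + C\<^sup>2 * (z t)\<^sup>2 / 2)"
    proof -
      have "b * (y t - Ra)\<^sup>2 / 2 \<ge> 0" "(\<sigma> * x t - C * z t)\<^sup>2 / 2 \<ge> 0"
        using b by simp_all
      moreover have "(\<sigma> * x t)\<^sup>2 / 2 = \<sigma> * (\<sigma> * (x t)\<^sup>2 / 2)" "(C * z t)\<^sup>2 / 2 = C\<^sup>2 * (z t)\<^sup>2 / 2"
        by (simp_all add: power2_eq_square)
      ultimately show ?thesis by linarith
    qed
    also have "\<dots> \<le> b * Ra\<^sup>2 / 2 - min \<sigma> 1 * V t"
    proof -
      \<comment> \<open>The three summands of \<open>V\<close> are damped at rates
        \<open>\<sigma>\<close>, 1 and 1, so \<open>V\<close> as a whole is damped at the smallest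
        of them.\<close>
      have "min \<sigma> 1 * (\<sigma> * (x t)\<^sup>2 / 2) \<le> \<sigma> * (\<sigma> * (x t)\<^sup>2 / 2)"
        "min \<sigma> 1 * (b * (y t)\<^sup>2 / 2) \<le> 1 * (b * (y t)\<^sup>2 / 2)"
        "min \<sigma> 1 * (C\<^sup>2 * (z t)\<^sup>2 / 2) \<le> 1 * (C\<^sup>2 * (z t)\<^sup>2 / 2)"
        using pos b by (intro mult_right_mono; simp)+
      then show ?thesis unfolding V_def distrib_left by linarith
    qed
    finally show ?thesis .
  qed
  have "\<exists>T\<ge>0. \<forall>t\<ge>T. V t \<le> M"
    using dissipative_eventually_le [of "min \<sigma> 1" V V', OF _ V le] M pos b_def by simp
  then show ?thesis
    by (simp add: ellipsoid_def V_def x_def y_def z_def b_def case_prod_beta)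
qed

lemma bounded_ellipsoid:
  assumes pos: "A > 0" "C > 0" "\<sigma> > 0"
  shows "bounded (ellipsoid A C \<sigma> M)"
proof -
  \<comment> \<open>A lower bound for all three weights, since that of \<open>y\<close> exceeds
    \<open>C\<^sup>2\<close>; the ellipsoid then lies in the ball of radius
    \<open>sqrt (2 * M / m)\<close>.\<close>
  define m where "m = min \<sigma> (C\<^sup>2)"
  have m: "m > 0" "m \<le> \<sigma>" "m \<le> C\<^sup>2" "m \<le> A * \<sigma> + C\<^sup>2"
    using pos by (auto simp: m_def min_le_iff_disj)
  have "norm p \<le> sqrt (2 * M / m)" if p: "p \<in> ellipsoid A C \<sigma> M" for p
  proof -
    obtain x y z where [simp]: "p = (x, y, z)" by (metis prod.collapse)
    have "m * x\<^sup>2 \<le> \<sigma> * x\<^sup>2" "m * y\<^sup>2 \<le> (A * \<sigma> + C\<^sup>2) * y\<^sup>2" "m * z\<^sup>2 \<le> C\<^sup>2 * z\<^sup>2"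
      using m by (auto intro!: mult_right_mono)
    then have "m * (x\<^sup>2 + (y\<^sup>2 + z\<^sup>2)) \<le> 2 * M"
      using p unfolding ellipsoid_def distrib_left by simp
    then show ?thesis
      using m by (simp add: norm_Pair field_simps)
  qed
  then show ?thesis unfolding bounded_iff by blast
qed

theorem theorem4p1:
  fixes A C \<sigma> Ra :: real
  assumes "A > 0" and "C > 0" and "\<sigma> > 0" and "Ra > 0"
  shows "(\<exists>M>0. global_attractor (vfield A C \<sigma> Ra) (ellipsoid A C \<sigma> M))
    \<and> ultimately_bounded (vfield A C \<sigma> Ra)"
proof -
  \<comment> \<open>Adding 1 to the nonnegative limiting level \<open>K / k\<close> gives both the
    strict inequality and \<open>M > 0\<close>.\<close>
  define M where "M = (A * \<sigma> + C\<^sup>2) * Ra\<^sup>2 / 2 / min \<sigma> 1 + 1"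
  have "(A * \<sigma> + C\<^sup>2) * Ra\<^sup>2 / 2 / min \<sigma> 1 \<ge> 0"
    using assms by (intro divide_nonneg_nonneg mult_nonneg_nonneg add_nonneg_nonneg) auto
  then have "M > 0" unfolding M_def by linarith
  \<comment> \<open>Every solution not only enters the ellipsoid but is in it at all later times
    from some \<open>T\<close> on; this is what ultimate boundedness needs.\<close>
  have in_ell: "\<exists>T\<ge>0. \<forall>t\<ge>T. u t \<in> ellipsoid A C \<sigma> M"
    if "forward_solution (vfield A C \<sigma> Ra) u" for u
    using eventually_in_ellipsoid [OF assms(1-3) _ that] by (simp add: M_def)
  obtain B where B: "B > 0" "\<And>p. p \<in> ellipsoid A C \<sigma> M \<Longrightarrow> norm p \<le> B"
    using bounded_ellipsoid [OF assms(1-3)] by (meson bounded_pos)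
  have "global_attractor (vfield A C \<sigma> Ra) (ellipsoid A C \<sigma> M)"
    unfolding global_attractor_def enters_def using in_ell by blast
  moreover have "ultimately_bounded (vfield A C \<sigma> Ra)"
    unfolding ultimately_bounded_def using in_ell B by meson
  ultimately show ?thesis using \<open>M > 0\<close> by blast
qed

end
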